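(* There is an absolute constant $C>0$ such that for every integer $N\ge1$ and every real $\alpha$ with $0\le\alpha<N$, $$C^{-1}\,\frac{1}{\alpha+\sqrt N}\ \le\ \rho(\psi_{N,\alpha})\ \le\ C\,\frac{1}{\alpha+\sqrt N}.$$
   Context: Here $[N]=\{1,\dots,N\}$ and $\{\pm1\}^N$ carries the normalized counting measure, $\mathbb{E}[f]=2^{-N}\sum_{x\in\{\pm1\}^N}f(x)$. For $f\colon\{\pm1\}^N\to\mathbb{R}$ and $S\subset[N]$ put $x^S=\prod_{k\in S}x_k$ ($x^\emptyset=1$), $\widehat f(S)=\mathbb{E}[f(x)x^S]$ and $\|f\|_\infty=\max_x|f(x)|$. The Boolean radius $\rho(f)$ of a nonconstant $f$ is the unique positive real number $\rho$ with $\sum_{S\subset[N]}|\widehat f(S)|\rho^{|S|}=\|f\|_\infty$. The threshold functions are $$\psi_{N,\alpha}\colon\{\pm1\}^N\to\{\pm1\},\qquad \psi_{N,\alpha}(x)=\operatorname{sign}(x_1+\dots+x_N-\alpha),$$ where $\operatorname{sign}(y)=1$ for $y\ge0$ and $\operatorname{sign}(y)=-1$ for $y<0$. *)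

theory Defs
  imports Complex_Main "HOL-Library.FuncSet"
begin

definition cube :: "nat \<Rightarrow> (nat \<Rightarrow> real) set" where
  "cube N = {1..N} \<rightarrow>\<^sub>E {-1, 1}"

definition cube_mean :: "nat \<Rightarrow> ((nat \<Rightarrow> real) \<Rightarrow> real) \<Rightarrow> real" where
  "cube_mean N f = (\<Sum>x\<in>cube N. f x) / 2 ^ N"

definition walsh :: "nat set \<Rightarrow> (nat \<Rightarrow> real) \<Rightarrow> real" where
  "walsh S x = (\<Prod>k\<in>S. x k)"

definition fourier_coeff :: "nat \<Rightarrow> ((nat \<Rightarrow> real) \<Rightarrow> real) \<Rightarrow> nat set \<Rightarrow> real" where
  "fourier_coeff N f S = cube_mean N (\<lambda>x. f x * walsh S x)"

definition cube_norm :: "nat \<Rightarrow> ((nat \<Rightarrow> real) \<Rightarrow> real) \<Rightarrow> real" where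
  "cube_norm N f = Max ((\<lambda>x. \<bar>f x\<bar>) ` cube N)"

(* Meaningful only when f is nonconstant on cube N; then exactly one such rho exists.
   Indeed the left-hand side is a polynomial in rho with nonnegative coefficients and some
   positive nonconstant coefficient, and its value at rho = 0 is |mean of f| < cube_norm N f. *)
definition boolean_radius :: "nat \<Rightarrow> ((nat \<Rightarrow> real) \<Rightarrow> real) \<Rightarrow> real" where
  "boolean_radius N f =
     (THE \<rho>. 0 < \<rho> \<and> (\<Sum>S\<in>Pow {1..N}. \<bar>fourier_coeff N f S\<bar> * \<rho> ^ card S) = cube_norm N f)"

(* The library function sgn differs: sgn 0 = 0. *)
definition sign1 :: "real \<Rightarrow> real" where
  "sign1 y = (if 0 \<le> y then 1 else -1)"

definition threshold :: "nat \<Rightarrow> real \<Rightarrow> (nat \<Rightarrow> real) \<Rightarrow> real" where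
  "threshold N \<alpha> x = sign1 ((\<Sum>k=1..N. x k) - \<alpha>)"

end

theory Submission
  imports Defs "HOL-Computational_Algebra.Polynomial"
begin

text \<open>
  Write a point of the cube as the set \<open>A\<close> of its coordinates equal to \<open>-1\<close>. The threshold
  function is then \<open>+1\<close> exactly when \<open>card A \<le> J\<close>, where \<open>J\<close> is the integer part of
  \<open>(N - \<alpha>) / 2\<close>, at most \<open>N / 2\<close>. Put \<open>T = (\<Sum>j\<le>J. N choose j)\<close> and \<open>p = T / 2 ^ N\<close>, so that the mean is
  \<open>2 * p - 1\<close>. The Boolean radius is the place where the polynomial
  \<open>F \<rho> = (\<Sum>S. \<bar>fourier_coeff S\<bar> * \<rho> ^ card S)\<close> takes the value \<open>1\<close>; hence \<open>F a \<le> 1 \<le> F b\<close>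
  puts it in \<open>{a..b}\<close> (\<open>boolean_radius_between\<close>). The coefficients of a symmetric
  function on one level are all equal, so no cancellation is lost in summing them first, and by
  the reciprocity of the Krawtchouk numbers level \<open>k\<close> of \<open>F\<close> has, for \<open>k \<ge> 1\<close>, the coefficient
  \<open>2 * \<bar>\<Sum>j\<le>J. (N choose j) * krawtchouk N j k\<bar> / 2 ^ N\<close> (\<open>majorant_threshold\<close>).

  For the upper bound on the radius only levels \<open>0\<close> and \<open>1\<close> matter. Level \<open>1\<close> has the coefficient
  \<open>2 * M / 2 ^ N\<close> with \<open>M = (\<Sum>j\<le>J. (N choose j) * (N - 2 * j))\<close>, and \<open>F \<rho> \<ge> 1\<close> follows from
  \<open>\<rho> * M \<ge> T\<close>. Each factor \<open>N - 2 * j\<close> is at least \<open>\<alpha>\<close>, so \<open>M \<ge> \<alpha> * T\<close>. That \<open>M\<close> is also at least a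
  constant times \<open>sqrt N * T\<close> follows from the telescoping identity \<open>M = (N - J) * (N choose J)\<close>, which
  makes each binomial coefficient in \<open>T\<close> at most \<open>2 * M / N\<close>
  (\<open>sqrt_mult_sum_choose_le\<close>).

  For the lower bound on the radius all levels have to be controlled. Because
  \<open>(1 - x) ^ j * (1 + x) ^ (N - j) = (1 - x\<^sup>2) ^ j * (1 + x) ^ (N - 2 * j)\<close>, the generating
  function of the numbers \<open>\<bar>krawtchouk N j k\<bar>\<close> at \<open>r\<close> is at most
  \<open>(1 + r\<^sup>2) ^ j * (1 + r) ^ (N - 2 * j)\<close>. With \<open>r = 1 / (\<alpha> + sqrt N)\<close> the first factor is bounded.
  The second, averaged over \<open>j \<le> J\<close> with the weights \<open>N choose j\<close>, is an exponential moment of the sum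
  of the coordinates, conditioned on that sum being at least \<open>\<alpha>\<close>. The excess over the threshold is stochastically largest for
  the threshold \<open>0\<close>, by log-concavity of the binomial coefficients, and there the moment
  is bounded by a direct computation (\<open>exp_tail_le\<close>). So \<open>F r - F 0\<close> is at most a constant
  times \<open>p\<close>. Replacing \<open>r\<close> by \<open>c * r\<close> multiplies this by at most \<open>c\<close>, and for a small \<open>c\<close> it drops
  below \<open>1 - F 0 = 2 * min p (1 - p)\<close>, since \<open>p \<le> 3 / 4\<close>.
\<close>

section \<open>Krawtchouk numbers\<close>

text \<open>
  The value of the Krawtchouk polynomial of degree \<open>j\<close> at \<open>k\<close>. For a set \<open>S\<close> of size \<open>k\<close> it is the
  sum of the Walsh character of \<open>S\<close> over the points with exactly \<open>j\<close> coordinates \<open>-1\<close>.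
\<close>

definition krawtchouk :: "nat \<Rightarrow> nat \<Rightarrow> nat \<Rightarrow> real" where
  "krawtchouk N k j = coeff ([:1, -1:] ^ k * [:1, 1:] ^ (N - k)) j"

lemma prod_monom: "finite A \<Longrightarrow> (\<Prod>u\<in>A. monom (e u) 1) = monom (\<Prod>u\<in>A. e u :: real) (card A)"
  by (induction A rule: finite_induct) (auto simp: mult_monom)

text \<open>
  Expand \<open>(\<Prod>u\<in>U. 1 + e u * x)\<close>, where \<open>e\<close> is \<open>-1\<close> on \<open>S\<close> and \<open>1\<close> elsewhere: choosing the second
  summand exactly for the \<open>u\<close> in \<open>A\<close> contributes the sign of \<open>A\<close> in degree \<open>card A\<close>.
\<close>

lemma sum_signs_eq_krawtchouk:
  assumes U: "finite U" and S: "S \<subseteq> U"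
  shows "(\<Sum>A | A \<subseteq> U \<and> card A = j. (-1) ^ card (S \<inter> A)) = krawtchouk (card U) (card S) j"
proof -
  define e where "e u = (if u \<in> S then -1 else 1 :: real)" for u
  have fS: "finite S" using assms finite_subset by blast
  have e: "(\<Prod>u\<in>A. e u) = (-1) ^ card (S \<inter> A)" if "A \<subseteq> U" for A
  proof -
    have "finite A" using that U finite_subset by blast
    then show ?thesis by (simp add: e_def prod.If_cases Int_commute)
  qed
  have "[:1, -1:] ^ card S * [:1, 1:] ^ (card U - card S)
      = (\<Prod>u\<in>U. if u \<in> S then [:1, -1 :: real:] else [:1, 1:])"
    using U S fS by (simp add: prod.If_cases Int_absorb1 card_Diff_subset
        flip: Diff_eq)
  also have "\<dots> = (\<Prod>u\<in>U. monom (e u) 1 + 1)"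
    by (intro prod.cong refl) (auto simp: e_def monom_Suc monom_0 one_pCons)
  also have "\<dots> = (\<Sum>A\<in>Pow U. \<Prod>u\<in>A. monom (e u) 1)"
    using U by (simp add: prod_add)
  also have "\<dots> = (\<Sum>A\<in>Pow U. monom ((-1) ^ card (S \<inter> A)) (card A))"
  proof (intro sum.cong refl)
    fix A assume "A \<in> Pow U"
    then show "(\<Prod>u\<in>A. monom (e u) 1) = monom ((-1) ^ card (S \<inter> A)) (card A)"
      using prod_monom[of A e] e[of A] U finite_subset by auto
  qed
  finally have "krawtchouk (card U) (card S) j
      = (\<Sum>A\<in>Pow U. if card A = j then (-1) ^ card (S \<inter> A) else 0)"
    by (simp add: krawtchouk_def coeff_sum)
  also have "\<dots> = (\<Sum>A\<in>{A \<in> Pow U. card A = j}. (-1) ^ card (S \<inter> A))"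
    using U by (intro sum.inter_filter [symmetric]) simp
  also have "{A \<in> Pow U. card A = j} = {A. A \<subseteq> U \<and> card A = j}"
    by auto
  finally show ?thesis by (rule sym)
qed

text \<open>
  Both sides are the sum of the sign \<open>(-1) ^ card (S \<inter> A)\<close>, which is symmetric in \<open>S\<close> and \<open>A\<close>, over all
  pairs with \<open>card S = k\<close> and \<open>card A = j\<close>.
\<close>

lemma krawtchouk_reciprocity:
  assumes "k \<le> N" "j \<le> N"
  shows "real (N choose k) * krawtchouk N k j = real (N choose j) * krawtchouk N j k"
proof -
  define P where "P i = {A. A \<subseteq> {1..N} \<and> card A = i}" for i
  have cP: "card (P i) = N choose i" for i
    using n_subsets[of "{1..N}" i] by (simp add: P_def)
  have K: "(\<Sum>A\<in>P j. (-1) ^ card (S \<inter> A)) = krawtchouk N k j" if "S \<in> P k" for S j k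
    using sum_signs_eq_krawtchouk[of "{1..N}" S j] that by (simp add: P_def)
  have "real (N choose k) * krawtchouk N k j = (\<Sum>S\<in>P k. krawtchouk N k j)"
    by (simp add: cP)
  also have "\<dots> = (\<Sum>S\<in>P k. \<Sum>A\<in>P j. (-1) ^ card (S \<inter> A))"
    by (simp add: K)
  also have "\<dots> = (\<Sum>A\<in>P j. \<Sum>S\<in>P k. (-1) ^ card (A \<inter> S))"
    by (subst sum.swap) (simp add: Int_commute)
  also have "\<dots> = real (N choose j) * krawtchouk N j k"
    by (simp add: K cP)
  finally show ?thesis .
qed

lemma krawtchouk_0: "krawtchouk N j 0 = 1"
  by (simp add: krawtchouk_def coeff_mult_0 coeff_0_power)

lemma degree_linear_power_le: "degree ([:1, c:] ^ n :: real poly) \<le> n"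
  by (rule order_trans[OF degree_power_le]) simp

lemma coeff_1_linear_power: "coeff ([:1, c:] ^ n) 1 = (real n * c)"
  by (induction n) (auto simp: coeff_mult coeff_0_power algebra_simps)

lemma krawtchouk_1: "j \<le> N \<Longrightarrow> krawtchouk N j 1 = real N - 2 * real j"
  using coeff_1_linear_power[of "-1" j] coeff_1_linear_power[of 1 "N - j"]
  by (simp add: krawtchouk_def coeff_mult coeff_0_power)

text \<open>
  The polynomial \<open>(1 - x) ^ k * (1 + x) ^ (N - k)\<close> vanishes at \<open>1\<close>. This is the orthogonality of
  a nontrivial character to the constants.
\<close>

lemma sum_krawtchouk_eq_0:
  assumes "1 \<le> k" "k \<le> N"
  shows "(\<Sum>j\<le>N. krawtchouk N k j) = 0"
proof -
  define p :: "real poly" where "p = [:1, -1:] ^ k * [:1, 1:] ^ (N - k)"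
  have "degree p \<le> N"
    unfolding p_def using assms degree_linear_power_le[of "-1" k] degree_linear_power_le[of 1 "N - k"]
    by (intro order_trans[OF degree_mult_le]) linarith
  then have "poly p 1 = (\<Sum>j\<le>N. coeff p j)"
    using poly_as_sum_of_monoms'[of p N] 
    by (metis (no_types, lifting) mult.right_neutral poly_monom poly_sum power_one sum.cong)
  moreover have "poly p 1 = 0"
    using assms by (simp add: p_def)
  ultimately show ?thesis by (simp add: krawtchouk_def p_def)
qed

lemma abs_coeff_mult_le:
  fixes p q p' q' :: "real poly"
  assumes "\<And>k. \<bar>coeff p k\<bar> \<le> coeff p' k" "\<And>k. \<bar>coeff q k\<bar> \<le> coeff q' k"
  shows "\<bar>coeff (p * q) k\<bar> \<le> coeff (p' * q') k"
proof -
  have "\<bar>coeff (p * q) k\<bar> \<le> (\<Sum>i\<le>k. \<bar>coeff p i\<bar> * \<bar>coeff q (k - i)\<bar>)"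
    unfolding coeff_mult by (rule order_trans[OF sum_abs]) (simp add: abs_mult)
  also have "\<dots> \<le> coeff (p' * q') k"
    unfolding coeff_mult using assms
    by (intro sum_mono mult_mono) (auto intro: order_trans[OF abs_ge_zero])
  finally show ?thesis .
qed

lemma abs_coeff_power_le:
  fixes p p' :: "real poly"
  assumes "\<And>k. \<bar>coeff p k\<bar> \<le> coeff p' k"
  shows "\<bar>coeff (p ^ n) k\<bar> \<le> coeff (p' ^ n) k"
proof (induction n arbitrary: k)
  case (Suc n)
  then show ?case using abs_coeff_mult_le[OF assms Suc.IH] by simp
qed simp

text \<open>
  Pairing each factor \<open>1 - x\<close> with a factor \<open>1 + x\<close> exhibits the cancellation; a bound on the
  unpaired product would only give \<open>(1 + t) ^ N\<close>.
\<close>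

lemma sum_abs_krawtchouk_le:
  assumes j: "2 * j \<le> N" and t: "0 \<le> t"
  shows "(\<Sum>k\<le>N. \<bar>krawtchouk N j k\<bar> * t ^ k) \<le> (1 + t\<^sup>2) ^ j * (1 + t) ^ (N - 2 * j)"
proof -
  define q :: "real poly" where "q = [:1, 0, 1:] ^ j * [:1, 1:] ^ (N - 2 * j)"
  have "N - j = j + (N - 2 * j)" using j by simp
  then have "[:1, -1:] ^ j * [:1, 1:] ^ (N - j)
      = ([:1, -1:] * [:1, 1:]) ^ j * [:1, 1 :: real:] ^ (N - 2 * j)"
    by (metis mult.assoc power_add power_mult_distrib)
  also have "[:1, -1:] * [:1, 1 :: real:] = [:1, 0, -1:]" by simp
  finally have K: "krawtchouk N j k = coeff ([:1, 0, -1:] ^ j * [:1, 1:] ^ (N - 2 * j)) k" for k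
    by (simp add: krawtchouk_def)
  have "\<bar>krawtchouk N j k\<bar> \<le> coeff q k" for k
    unfolding K q_def
    by (intro abs_coeff_mult_le abs_coeff_power_le)
       (auto simp: coeff_pCons split: nat.split)
  then have "(\<Sum>k\<le>N. \<bar>krawtchouk N j k\<bar> * t ^ k) \<le> (\<Sum>k\<le>N. coeff q k * t ^ k)"
    using t by (intro sum_mono mult_right_mono) auto
  also have "\<dots> = poly q t"
  proof -
    have "degree ([:1, 0, 1:] ^ j :: real poly) \<le> 2 * j"
      by (rule order_trans[OF degree_power_le]) simp
    then have "degree q \<le> N"
      unfolding q_def using j degree_linear_power_le[of 1 "N - 2 * j"]
      by (intro order_trans[OF degree_mult_le]) linarith
    then show ?thesis
      using poly_as_sum_of_monoms'[of q N] 
      by (metis (no_types, lifting) poly_monom poly_sum sum.cong)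
  qed
  also have "\<dots> = (1 + t\<^sup>2) ^ j * (1 + t) ^ (N - 2 * j)"
    by (simp add: q_def power2_eq_square)
  finally show ?thesis .
qed

section \<open>Partial sums of binomial coefficients\<close>

lemma choose_log_concave_step:
  assumes "a \<le> b"
  shows "(N choose a) * (N choose Suc b) \<le> (N choose Suc a) * (N choose b)"
proof (cases "b < N")
  case True
  have a: "Suc a * (N choose Suc a) = (N - a) * (N choose a)"
    and b: "Suc b * (N choose Suc b) = (N - b) * (N choose b)"
    by (metis binomial_absorb_comp binomial_absorption)+
  have "(Suc a * Suc b) * ((N choose a) * (N choose Suc b))
      = (Suc a * (N - b)) * ((N choose a) * (N choose b))"
    using b by (metis mult.assoc mult.left_commute)
  also have "\<dots> \<le> (Suc b * (N - a)) * ((N choose a) * (N choose b))"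
    using assms by (intro mult_right_mono mult_mono) auto
  also have "\<dots> = (Suc a * Suc b) * ((N choose Suc a) * (N choose b))"
    using a by (metis mult.assoc mult.left_commute)
  finally show ?thesis
    by (subst (asm) mult_le_cancel1) simp
qed (simp add: binomial_eq_0)

text \<open>
  Telescoping of the one-step inequality; the product of the intermediate coefficients \<open>c\<close>
  cancels unless it is \<open>0\<close>, and then \<open>b + Suc d\<close> exceeds \<open>N\<close>.
\<close>

lemma choose_log_concave:
  assumes "a \<le> b"
  shows "(N choose a) * (N choose (b + d)) \<le> (N choose (a + d)) * (N choose b)"
proof (induction d)
  case (Suc d)
  show ?case
  proof (cases "b + d < N")
    case True
    define c where "c = (N choose (a + d)) * (N choose (b + d))"
    have "c * ((N choose a) * (N choose (b + Suc d)))
        = ((N choose a) * (N choose (b + d))) * ((N choose (a + d)) * (N choose Suc (b + d)))"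
      by (simp add: c_def)
    also have "\<dots> \<le> ((N choose (a + d)) * (N choose b)) * ((N choose Suc (a + d)) * (N choose (b + d)))"
      using assms by (intro mult_mono Suc.IH choose_log_concave_step) auto
    also have "\<dots> = c * ((N choose (a + Suc d)) * (N choose b))"
      by (simp add: c_def)
    finally have "c * ((N choose a) * (N choose (b + Suc d))) \<le> c * ((N choose (a + Suc d)) * (N choose b))" .
    moreover have "0 < c" using True assms by (simp add: c_def)
    ultimately show ?thesis by simp
  qed (simp add: binomial_eq_0)
qed simp

text \<open>
  The hypothesis on \<open>A\<close> and \<open>B\<close> is a monotone likelihood ratio: the probability distribution
  proportional to \<open>A\<close> is stochastically smaller than the one proportional to \<open>B\<close>, so an
  increasing \<open>w\<close> has the smaller mean under the former. As for Chebyshev's sum inequality, the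
  double sum of the differences is symmetrised.
\<close>

lemma weighted_Chebyshev:
  fixes A B w :: "'i::linorder \<Rightarrow> real"
  assumes w: "\<And>i k. k \<in> I \<Longrightarrow> i \<in> I \<Longrightarrow> k \<le> i \<Longrightarrow> w k \<le> w i"
    and AB: "\<And>i k. k \<in> I \<Longrightarrow> i \<in> I \<Longrightarrow> k \<le> i \<Longrightarrow> A i * B k \<le> A k * B i"
  shows "(\<Sum>i\<in>I. A i * w i) * (\<Sum>i\<in>I. B i) \<le> (\<Sum>i\<in>I. A i) * (\<Sum>i\<in>I. B i * w i)"
proof -
  define D where "D i k = A i * B k * (w i - w k)" for i k
  have "D i k + D k i \<le> 0" if "i \<in> I" "k \<in> I" for i k
  proof -
    have "D i k + D k i = (A i * B k - A k * B i) * (w i - w k)"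
      by (simp add: D_def algebra_simps)
    also have "\<dots> \<le> 0"
      using w[of k i] w[of i k] AB[of k i] AB[of i k] that
      by (cases "k \<le> i") (auto simp: mult_le_0_iff)
    finally show ?thesis .
  qed
  then have "(\<Sum>i\<in>I. \<Sum>k\<in>I. D i k + D k i) \<le> 0"
    by (intro sum_nonpos) auto
  moreover have "(\<Sum>i\<in>I. \<Sum>k\<in>I. D k i) = (\<Sum>i\<in>I. \<Sum>k\<in>I. D i k)"
    by (rule sum.swap)
  ultimately have "(\<Sum>i\<in>I. \<Sum>k\<in>I. D i k) \<le> 0"
    by (simp add: sum.distrib)
  moreover have "(\<Sum>i\<in>I. \<Sum>k\<in>I. D i k)
      = (\<Sum>i\<in>I. A i * w i) * (\<Sum>k\<in>I. B k) - (\<Sum>i\<in>I. A i) * (\<Sum>k\<in>I. B k * w k)"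
    unfolding sum_product sum_subtractf[symmetric] by (simp add: D_def algebra_simps)
  ultimately show ?thesis by simp
qed


lemma sum_choose_reflect:
  "2 * (\<Sum>j\<le>J. real (N choose j))
     = (\<Sum>j\<le>N. real (N choose j) * (of_bool (j \<le> J) + of_bool (N - j \<le> J)))"
proof -
  have "(\<Sum>j\<le>J. real (N choose j)) = (\<Sum>j\<in>{..N} \<union> {..J}. real (N choose j) * of_bool (j \<le> J))"
    by (intro sum.mono_neutral_cong_left) auto
  also have "\<dots> = (\<Sum>j\<le>N. real (N choose j) * of_bool (j \<le> J))"
    by (intro sum.mono_neutral_cong_right) (auto simp: binomial_eq_0)
  finally have 1: "(\<Sum>j\<le>J. real (N choose j)) = (\<Sum>j\<le>N. real (N choose j) * of_bool (j \<le> J))" .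
  moreover have "\<dots> = (\<Sum>j\<le>N. real (N choose j) * of_bool (N - j \<le> J))"
    by (rule sum.reindex_bij_witness[where i = "\<lambda>j. N - j" and j = "\<lambda>j. N - j"])
       (auto simp: binomial_symmetric[symmetric])
  ultimately show ?thesis by (simp add: distrib_left sum.distrib)
qed

lemma sum_choose_real: "(\<Sum>j\<le>N. real (N choose j)) = 2 ^ N"
  using choose_row_sum[of N] by (metis of_nat_numeral of_nat_power of_nat_sum)

lemma half_le_sum_choose:
  assumes "N \<le> 2 * J + 1"
  shows "2 ^ N \<le> 2 * (\<Sum>j\<le>J. real (N choose j))"
  unfolding sum_choose_reflect sum_choose_real[symmetric]
  using assms by (intro sum_mono) (auto simp: mult_le_cancel_left1)

lemma sum_choose_le_half:
  assumes "2 * J < N"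
  shows "2 * (\<Sum>j\<le>J. real (N choose j)) \<le> 2 ^ N"
  unfolding sum_choose_reflect sum_choose_real[symmetric]
  using assms by (intro sum_mono) (auto simp: mult_le_cancel_left2)

text \<open>
  The constant must be below \<open>1\<close>; it cannot be \<open>1 / 2\<close>, because for \<open>N = 2 * J\<close> the middle coefficient
  is counted in full. By Pascal's rule the sum is a sum of two partial row sums for \<open>N - 1\<close>, the
  second of which stops before the middle of its row.
\<close>

lemma sum_choose_le_three_quarters:
  assumes "1 \<le> N" "2 * J \<le> N"
  shows "(\<Sum>j\<le>J. real (N choose j)) \<le> 3 / 4 * 2 ^ N"
proof (cases J)
  case 0
  have "(2 :: real) ^ 1 \<le> 2 ^ N" using assms by (intro power_increasing) auto
  then show ?thesis using 0 by simp
next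
  case (Suc I)
  obtain M where N: "N = Suc M" using assms by (cases N) auto
  have "(\<Sum>j\<le>J. real (N choose j)) = (\<Sum>j\<le>J. real (M choose j)) + (\<Sum>j\<le>I. real (M choose j))"
    unfolding Suc N by (subst (1 2) sum.atMost_Suc_shift) (simp add: sum.distrib)
  moreover have "(\<Sum>j\<le>J. real (M choose j)) \<le> (\<Sum>j\<le>M. real (M choose j))"
    using assms Suc N by (intro sum_mono2) auto
  moreover have "2 * (\<Sum>j\<le>I. real (M choose j)) \<le> 2 ^ M"
    using assms Suc N by (intro sum_choose_le_half) auto
  ultimately show ?thesis by (simp add: sum_choose_real N)
qed

text \<open>
  The summand is the increment of the right-hand side, since
  \<open>Suc J * (N choose Suc J) = (N - J) * (N choose J)\<close>.
\<close>

lemma sum_choose_diff: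
  assumes "J \<le> N"
  shows "(\<Sum>j\<le>J. real (N choose j) * (real N - 2 * real j)) = (real N - real J) * real (N choose J)"
  using assms
proof (induction J)
  case (Suc J)
  have "Suc J * (N choose Suc J) = (N - J) * (N choose J)"
    by (metis binomial_absorb_comp binomial_absorption)
  then have "real (Suc J) * real (N choose Suc J) = (real N - real J) * real (N choose J)"
    using Suc.prems by (metis of_nat_diff of_nat_mult Suc_leD)
  then show ?case using Suc by (simp add: algebra_simps)
qed simp

text \<open>
  For a uniformly random set \<open>A\<close> and \<open>X = N - 2 * card A\<close> this bounds the mean of
  \<open>(1 + t) ^ X\<close> conditioned on \<open>card A \<le> J\<close>. In terms of the excess \<open>i = J - j\<close> the weights are
  \<open>N choose (J - i)\<close>; by log-concavity they decay faster in \<open>i\<close> than the weights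
  \<open>N choose (H - i)\<close> with \<open>H = N div 2\<close>. So replacing \<open>J\<close> by \<open>H\<close> only increases the conditional mean of
  \<open>(1 + t) ^ (2 * i)\<close>. The event \<open>card A \<le> H\<close> has probability at least
  \<open>1 / 2\<close>, and hence conditioning on it costs no more than a factor \<open>2\<close> against the full binomial sum.
\<close>

lemma exp_tail_le:
  assumes J: "2 * J \<le> N" and t: "0 \<le> t" and Nt: "real N * t\<^sup>2 \<le> 1"
  shows "(\<Sum>j\<le>J. real (N choose j) * (1 + t) ^ (N - 2 * j))
     \<le> 2 * exp (1/2) * (1 + t) ^ (N - 2 * J) * (\<Sum>j\<le>J. real (N choose j))"
proof -
  define H where "H = N div 2"
  define y where "y = (1 + t)\<^sup>2"
  define T where "T I = (\<Sum>j\<le>I. real (N choose j))" for I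
  define W where "W I = (\<Sum>j\<le>I. real (N choose j) * y ^ (I - j))" for I
  \<comment> \<open>natural subtraction makes \<open>I - i\<close> equal to \<open>0\<close> for \<open>i > I\<close>, so these weights are cut off explicitly\<close>
  define a where "a I i = (if i \<le> I then real (N choose (I - i)) else 0)" for I i
  have y: "1 \<le> y" using t by (simp add: y_def)
  have T0: "0 \<le> T I" for I by (auto simp: T_def intro: sum_nonneg)
  have JH: "J \<le> H" using J by (simp add: H_def)
  have reindex: "(\<Sum>i\<le>H. a I i * g i) = (\<Sum>j\<le>I. real (N choose j) * g (I - j))"
    if "I \<le> H" for I and g :: "nat \<Rightarrow> real"
  proof -
    have "(\<Sum>i\<le>H. a I i * g i) = (\<Sum>i\<le>I. real (N choose (I - i)) * g i)"
      using that by (intro sum.mono_neutral_cong_right) (auto simp: a_def)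
    also have "\<dots> = (\<Sum>j\<le>I. real (N choose j) * g (I - j))"
      by (rule sum.reindex_bij_witness[where i = "\<lambda>j. I - j" and j = "\<lambda>j. I - j"]) auto
    finally show ?thesis .
  qed
  have cross: "a J i * a H k \<le> a J k * a H i" if "k \<in> {..H}" "i \<in> {..H}" "k \<le> i" for i k
  proof (cases "i \<le> J")
    case True
    have "(N choose (J - i)) * (N choose ((H - i) + (i - k)))
        \<le> (N choose ((J - i) + (i - k))) * (N choose (H - i))"
      using JH by (intro choose_log_concave) auto
    then have "(N choose (J - i)) * (N choose (H - k)) \<le> (N choose (J - k)) * (N choose (H - i))"
      using that True by simp
    then show ?thesis
      using that True by (simp add: a_def flip: of_nat_mult)
  qed (simp add: a_def)
  have "(\<Sum>i\<le>H. a J i * y ^ i) * (\<Sum>i\<le>H. a H i) \<le> (\<Sum>i\<le>H. a J i) * (\<Sum>i\<le>H. a H i * y ^ i)"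
    using y cross by (intro weighted_Chebyshev) (auto intro: power_increasing)
  then have WT: "W J * T H \<le> T J * W H"
    using reindex[OF JH, of "\<lambda>i. y ^ i"] reindex[OF order_refl, of "\<lambda>i. y ^ i"]
      reindex[OF JH, of "\<lambda>i. 1"] reindex[OF order_refl, of "\<lambda>i. 1"]
    by (simp add: W_def T_def)
  have "W H \<le> (\<Sum>j\<le>N. real (N choose j) * (1 / (1 + t)) ^ j * (1 + t) ^ (N - j))"
  proof -
    have "W H \<le> (\<Sum>j\<le>H. real (N choose j) * (1 / (1 + t)) ^ j * (1 + t) ^ (N - j))"
      unfolding W_def mult.assoc
    proof (intro sum_mono mult_left_mono)
      fix j assume "j \<in> {..H}"
      then have j: "j \<le> N - j" "2 * (H - j) \<le> N - j - j" by (auto simp: H_def)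
      have "y ^ (H - j) = (1 + t) ^ (2 * (H - j))"
        by (simp add: y_def power_mult)
      also have "\<dots> \<le> (1 + t) ^ (N - j - j)"
        using j t by (intro power_increasing) auto
      also have "\<dots> = (1 / (1 + t)) ^ j * (1 + t) ^ (N - j)"
        using j t by (simp add: power_diff power_divide flip: power_add)
      finally show "y ^ (H - j) \<le> (1 / (1 + t)) ^ j * (1 + t) ^ (N - j)" .
    qed simp
    also have "\<dots> \<le> (\<Sum>j\<le>N. real (N choose j) * (1 / (1 + t)) ^ j * (1 + t) ^ (N - j))"
      using t by (intro sum_mono2) (auto simp: H_def)
    finally show ?thesis .
  qed
  also have "\<dots> = (1 / (1 + t) + (1 + t)) ^ N"
    by (simp add: binomial_ring)
  also have "\<dots> \<le> (2 * exp (t\<^sup>2 / 2)) ^ N"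
  proof (rule power_mono)
    have "1 / (1 + t) + (1 + t) = 2 + t\<^sup>2 / (1 + t)"
      using t by (simp add: field_simps power2_eq_square)
    also have "\<dots> \<le> 2 + t\<^sup>2"
      using t by (simp add: field_simps)
    also have "\<dots> \<le> 2 * exp (t\<^sup>2 / 2)"
      using exp_ge_add_one_self[of "t\<^sup>2 / 2"] by linarith
    finally show "1 / (1 + t) + (1 + t) \<le> 2 * exp (t\<^sup>2 / 2)" .
  qed (use t in simp)
  also have "\<dots> = 2 ^ N * exp (real N * t\<^sup>2 / 2)"
    by (simp add: power_mult_distrib flip: exp_of_nat_mult)
  also have "\<dots> \<le> 2 ^ N * exp (1/2)"
    using Nt by simp
  finally have WH: "W H \<le> 2 ^ N * exp (1/2)" .
  have WJ: "W J \<le> 2 * exp (1/2) * T J"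
  proof -
    have "0 \<le> W J" unfolding W_def using y by (intro sum_nonneg) auto
    then have "2 ^ N * W J \<le> 2 * T H * W J"
      using half_le_sum_choose[of N H] by (intro mult_right_mono) (auto simp: T_def H_def)
    also have "\<dots> \<le> 2 * (T J * W H)" using WT by (simp add: mult_ac)
    also have "\<dots> \<le> 2 * (T J * (2 ^ N * exp (1/2)))"
      using WH T0 by (intro mult_left_mono) auto
    finally have "2 ^ N * W J \<le> 2 ^ N * (2 * exp (1/2) * T J)" by (simp add: mult_ac)
    then show ?thesis by simp
  qed
  have "(\<Sum>j\<le>J. real (N choose j) * (1 + t) ^ (N - 2 * j)) = (1 + t) ^ (N - 2 * J) * W J"
    unfolding W_def sum_distrib_left
  proof (intro sum.cong refl)
    fix j assume "j \<in> {..J}"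
    then have "N - 2 * j = (N - 2 * J) + 2 * (J - j)" using J by simp
    then show "real (N choose j) * (1 + t) ^ (N - 2 * j)
        = (1 + t) ^ (N - 2 * J) * (real (N choose j) * y ^ (J - j))"
      by (simp add: power_add power_mult y_def)
  qed
  also have "\<dots> \<le> (1 + t) ^ (N - 2 * J) * (2 * exp (1/2) * T J)"
    using WJ t by (intro mult_left_mono) auto
  finally show ?thesis by (simp add: T_def mult_ac)
qed

text \<open>
  Let \<open>M\<close> be the sum on the right. The indices with \<open>N - 2 * j \<ge> sqrt N\<close> contribute to the left-hand side
  at most \<open>M\<close>. The others number at most \<open>sqrt N / 2 + 1\<close>, and by \<open>sum_choose_diff\<close> each of their
  binomial coefficients is at most \<open>2 * M / N\<close>.
\<close>

lemma sqrt_mult_sum_choose_le: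
  assumes J: "2 * J \<le> N" and N: "1 \<le> N"
  shows "sqrt (real N) * (\<Sum>j\<le>J. real (N choose j))
     \<le> 4 * (\<Sum>j\<le>J. real (N choose j) * (real N - 2 * real j))"
proof -
  define s where "s = sqrt (real N)"
  define M where "M I = (\<Sum>j\<le>I. real (N choose j) * (real N - 2 * real j))" for I
  define X where "X = {j. j \<le> J \<and> real N - 2 * real j < s}"
  have s: "1 \<le> s" "s * s = real N" using N by (auto simp: s_def)
  have M0: "0 \<le> M J" unfolding M_def using J by (intro sum_nonneg) auto
  have choose_le: "s * real (N choose j) \<le> 2 * M J / s" if "j \<le> J" for j
  proof -
    have "real N / 2 * real (N choose j) \<le> (real N - real j) * real (N choose j)"
      using that J by (intro mult_right_mono) auto
    also have "\<dots> = M j" unfolding M_def using that J by (intro sum_choose_diff[symmetric]) auto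
    also have "\<dots> \<le> M J" unfolding M_def using that J by (intro sum_mono2) auto
    finally have "s * s * real (N choose j) \<le> 2 * M J" by (simp add: s(2))
    then show ?thesis using s(1) by (simp add: pos_le_divide_eq mult_ac)
  qed
  have "real (card X) \<le> s / 2 + 1"
  proof -
    \<comment> \<open>the indices in \<open>X\<close> lie within \<open>s / 2\<close> below the middle index\<close>
    have "X \<subseteq> (\<lambda>i. N div 2 - i) ` {..nat \<lfloor>s / 2\<rfloor>}"
    proof
      fix j assume j: "j \<in> X"
      then have "real (N div 2 - j) \<le> s / 2" using J by (auto simp: X_def)
      then have "N div 2 - j \<le> nat \<lfloor>s / 2\<rfloor>" by linarith
      moreover have "j = N div 2 - (N div 2 - j)" using j J by (auto simp: X_def)
      ultimately show "j \<in> (\<lambda>i. N div 2 - i) ` {..nat \<lfloor>s / 2\<rfloor>}" by blast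
    qed
    then have "card X \<le> card {..nat \<lfloor>s / 2\<rfloor>}"
      by (meson surj_card_le finite_atMost)
    then show ?thesis using s(1) by simp linarith
  qed
  have "s * (\<Sum>j\<le>J. real (N choose j))
      \<le> (\<Sum>j\<le>J. real (N choose j) * (real N - 2 * real j) + (if j \<in> X then 2 * M J / s else 0))"
    unfolding sum_distrib_left
  proof (intro sum_mono)
    fix j assume j: "j \<in> {..J}"
    show "s * real (N choose j)
      \<le> real (N choose j) * (real N - 2 * real j) + (if j \<in> X then 2 * M J / s else 0)"
    proof (cases "j \<in> X")
      case True
      have "0 \<le> real (N choose j) * (real N - 2 * real j)" using j J by auto
      then show ?thesis using True choose_le[of j] j by simp
    next
      case False
      then have "s \<le> real N - 2 * real j" using j by (auto simp: X_def)
      then have "real (N choose j) * s \<le> real (N choose j) * (real N - 2 * real j)"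
        by (intro mult_left_mono) auto
      then show ?thesis using False by (simp add: mult.commute)
    qed
  qed
  also have "\<dots> = M J + real (card X) * (2 * M J / s)"
  proof -
    have "{..J} \<inter> X = X" by (auto simp: X_def)
    then show ?thesis by (simp add: sum.distrib M_def sum.If_cases)
  qed
  also have "\<dots> \<le> M J + (s / 2 + 1) * (2 * M J / s)"
    using \<open>real (card X) \<le> s / 2 + 1\<close> M0 s by (intro add_left_mono mult_right_mono) auto
  also have "\<dots> = 2 * M J + 2 * M J / s"
    using s by (simp add: field_simps)
  also have "\<dots> \<le> 4 * M J"
  proof -
    have "2 * M J / s \<le> 2 * M J / 1" using s M0 by (intro divide_left_mono) auto
    then show ?thesis by simp
  qed
  finally show ?thesis by (simp add: s_def M_def)
qed

section \<open>Locating the Boolean radius\<close>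

definition majorant :: "nat \<Rightarrow> ((nat \<Rightarrow> real) \<Rightarrow> real) \<Rightarrow> real \<Rightarrow> real" where
  "majorant N f \<rho> = (\<Sum>S\<in>Pow {1..N}. \<bar>fourier_coeff N f S\<bar> * \<rho> ^ card S)"

lemma majorant_0: "majorant N f 0 = \<bar>cube_mean N f\<bar>"
proof -
  have "majorant N f 0 = (\<Sum>S\<in>{{}}. \<bar>fourier_coeff N f S\<bar> * 0 ^ card S)"
    unfolding majorant_def
    by (intro sum.mono_neutral_right) (auto simp: card_eq_0_iff dest: finite_subset)
  then show ?thesis by (simp add: fourier_coeff_def walsh_def)
qed

text \<open>
  Convexity in its crudest form: all powers except the constant one shrink at least by the factor \<open>c\<close>.
  This gives both the uniqueness of the Boolean radius and the smallness of the
  nonconstant part near \<open>0\<close>.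
\<close>

lemma majorant_scale_le:
  assumes "0 \<le> c" "c \<le> 1" "0 \<le> \<rho>"
  shows "majorant N f (c * \<rho>) \<le> (1 - c) * majorant N f 0 + c * majorant N f \<rho>"
  unfolding majorant_def sum_distrib_left sum.distrib[symmetric]
proof (intro sum_mono)
  fix S assume "S \<in> Pow {1..N}"
  \<comment> \<open>\<open>0 ^ card S\<close> is \<open>1\<close> for the empty set, the constant term, and \<open>0\<close> for all others\<close>
  have "(c * \<rho>) ^ card S \<le> (1 - c) * 0 ^ card S + c * \<rho> ^ card S"
  proof (cases "card S")
    case (Suc n)
    have "c ^ Suc n \<le> c" using assms by (simp add: mult_left_le power_le_one)
    then show ?thesis using assms Suc
      by (simp only: power_mult_distrib) (simp add: mult_right_mono)
  qed simp
  then have "\<bar>fourier_coeff N f S\<bar> * (c * \<rho>) ^ card S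
      \<le> \<bar>fourier_coeff N f S\<bar> * ((1 - c) * 0 ^ card S + c * \<rho> ^ card S)"
    by (intro mult_left_mono) auto
  then show "\<bar>fourier_coeff N f S\<bar> * (c * \<rho>) ^ card S
      \<le> (1 - c) * (\<bar>fourier_coeff N f S\<bar> * 0 ^ card S) + c * (\<bar>fourier_coeff N f S\<bar> * \<rho> ^ card S)"
    by (simp add: algebra_simps)
qed

text \<open>
  The intermediate value theorem gives a solution between \<open>a\<close> and \<open>b\<close>. Two solutions
  \<open>\<rho> < \<sigma>\<close> would contradict \<open>majorant_scale_le\<close>, which puts the value at \<open>\<rho>\<close> strictly below the
  common value, as the value at \<open>0\<close> is smaller.
\<close>

lemma boolean_radius_between:
  assumes mean: "\<bar>cube_mean N f\<bar> < cube_norm N f"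
    and ab: "0 < a" "a \<le> b" "majorant N f a \<le> cube_norm N f" "cube_norm N f \<le> majorant N f b"
  shows "a \<le> boolean_radius N f" "boolean_radius N f \<le> b"
proof -
  define F where "F = majorant N f"
  define m where "m = cube_norm N f"
  have F0: "F 0 < m" using mean by (simp add: F_def m_def majorant_0)
  have "continuous_on {a..b} F"
    unfolding F_def majorant_def by (intro continuous_intros)
  then obtain r where r: "a \<le> r" "r \<le> b" "F r = m"
    using IVT'[of F a m b] ab by (auto simp: F_def m_def)
  have no_two: False if "0 < \<rho>" "\<rho> < \<sigma>" "F \<rho> = m" "F \<sigma> = m" for \<rho> \<sigma>
  proof -
    have "F (\<rho> / \<sigma> * \<sigma>) \<le> (1 - \<rho> / \<sigma>) * F 0 + \<rho> / \<sigma> * F \<sigma>"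
      unfolding F_def using that by (intro majorant_scale_le) auto
    then have "(1 - \<rho> / \<sigma>) * m \<le> (1 - \<rho> / \<sigma>) * F 0"
      using that by (simp add: algebra_simps)
    then show False using that F0 by (simp add: mult_le_cancel_left)
  qed
  have "boolean_radius N f = r"
    unfolding boolean_radius_def
  proof (rule the_equality)
    show "0 < r \<and> (\<Sum>S\<in>Pow {1..N}. \<bar>fourier_coeff N f S\<bar> * r ^ card S) = cube_norm N f"
      using r ab by (simp add: F_def m_def majorant_def)
  next
    fix \<rho> assume "0 < \<rho> \<and> (\<Sum>S\<in>Pow {1..N}. \<bar>fourier_coeff N f S\<bar> * \<rho> ^ card S) = cube_norm N f"
    then have "0 < \<rho>" "F \<rho> = m" by (auto simp: F_def m_def majorant_def)
    then show "\<rho> = r" using no_two[of \<rho> r] no_two[of r \<rho>] r ab by fastforce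
  qed
  then show "a \<le> boolean_radius N f" "boolean_radius N f \<le> b" using r by auto
qed

section \<open>Symmetric functions on the cube\<close>

definition point :: "nat \<Rightarrow> nat set \<Rightarrow> nat \<Rightarrow> real" where
  "point N A = (\<lambda>k\<in>{1..N}. if k \<in> A then -1 else 1)"

lemma bij_betw_point: "bij_betw (point N) (Pow {1..N}) (cube N)"
proof (rule bij_betw_byWitness[where f' = "\<lambda>x. {k \<in> {1..N}. x k = -1}"])
  show "\<forall>x\<in>cube N. point N {k \<in> {1..N}. x k = -1} = x"
    by (force simp: cube_def point_def PiE_def extensional_def Pi_def fun_eq_iff)
qed (auto simp: cube_def point_def)

lemma sum_cube: "(\<Sum>x\<in>cube N. h x) = (\<Sum>A\<in>Pow {1..N}. h (point N A))"
  using sum.reindex_bij_betw[OF bij_betw_point] by metis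

lemma walsh_point:
  assumes "S \<subseteq> {1..N}"
  shows "walsh S (point N A) = (-1) ^ card (S \<inter> A)"
proof -
  have "finite S" using assms finite_subset by blast
  moreover have "walsh S (point N A) = (\<Prod>k\<in>S. if k \<in> A then -1 else 1)"
    unfolding walsh_def using assms by (intro prod.cong) (auto simp: point_def)
  ultimately show ?thesis by (simp add: prod.If_cases)
qed

lemma sum_point:
  assumes "A \<subseteq> {1..N}"
  shows "(\<Sum>k=1..N. point N A k) = real N - 2 * real (card A)"
proof -
  have "(\<Sum>k=1..N. point N A k) = (\<Sum>k=1..N. 1 - 2 * of_bool (k \<in> A))"
    by (intro sum.cong) (auto simp: point_def)
  also have "\<dots> = real N - 2 * (\<Sum>k=1..N. of_bool (k \<in> A))"
    by (simp add: sum_subtractf sum_distrib_left)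
  also have "(\<Sum>k=1..N. of_bool (k \<in> A)) = real (card A)"
    using assms by (simp add: Int_absorb2 Int_commute)
  finally show ?thesis .
qed

lemma fourier_coeff_symmetric:
  assumes f: "\<And>A. A \<subseteq> {1..N} \<Longrightarrow> f (point N A) = \<phi> (card A)" and S: "S \<subseteq> {1..N}"
  shows "fourier_coeff N f S = (\<Sum>j\<le>N. \<phi> j * krawtchouk N (card S) j) / 2 ^ N"
proof -
  have "(\<Sum>x\<in>cube N. f x * walsh S x) = (\<Sum>A\<in>Pow {1..N}. \<phi> (card A) * (-1) ^ card (S \<inter> A))"
    unfolding sum_cube using S by (intro sum.cong) (auto simp: f walsh_point)
  also have "\<dots> = (\<Sum>j\<le>N. \<Sum>A\<in>{A \<in> Pow {1..N}. card A = j}. \<phi> (card A) * (-1) ^ card (S \<inter> A))"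
    by (rule sum.group[symmetric]) (auto dest: card_mono[rotated])
  also have "\<dots> = (\<Sum>j\<le>N. \<phi> j * krawtchouk N (card S) j)"
  proof (intro sum.cong refl)
    fix j
    have "{A \<in> Pow {1..N}. card A = j} = {A. A \<subseteq> {1..N} \<and> card A = j}" by auto
    then show "(\<Sum>A\<in>{A \<in> Pow {1..N}. card A = j}. \<phi> (card A) * (-1) ^ card (S \<inter> A))
        = \<phi> j * krawtchouk N (card S) j"
      using sum_signs_eq_krawtchouk[of "{1..N}" S j] S
      by (simp add: sum_distrib_left[symmetric])
  qed
  finally show ?thesis by (simp add: fourier_coeff_def cube_mean_def)
qed

text \<open>
  The point of this form is that the absolute value stands outside the sum over \<open>j\<close>, with
  \<open>krawtchouk N j k\<close>, a coefficient of a polynomial depending on \<open>j\<close> only, inside: reciprocity has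
  exchanged the roles of frequency and position.
\<close>

lemma majorant_symmetric:
  assumes f: "\<And>A. A \<subseteq> {1..N} \<Longrightarrow> f (point N A) = \<phi> (card A)"
  shows "majorant N f \<rho>
    = (\<Sum>k\<le>N. \<bar>\<Sum>j\<le>N. \<phi> j * (real (N choose j) * krawtchouk N j k)\<bar> / 2 ^ N * \<rho> ^ k)"
proof -
  define d where "d k = \<bar>\<Sum>j\<le>N. \<phi> j * krawtchouk N k j\<bar> / 2 ^ N" for k
  have "majorant N f \<rho> = (\<Sum>S\<in>Pow {1..N}. d (card S) * \<rho> ^ card S)"
    unfolding majorant_def using fourier_coeff_symmetric[of N f \<phi>, OF f]
    by (intro sum.cong) (auto simp: d_def)
  also have "\<dots> = (\<Sum>k\<le>N. \<Sum>S\<in>{S \<in> Pow {1..N}. card S = k}. d (card S) * \<rho> ^ card S)"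
    by (rule sum.group[symmetric]) (auto dest: card_mono[rotated])
  also have "\<dots> = (\<Sum>k\<le>N. real (N choose k) * d k * \<rho> ^ k)"
    using n_subsets[of "{1..N}"] by (intro sum.cong) (auto simp: Pow_def)
  also have "\<dots> = (\<Sum>k\<le>N. \<bar>\<Sum>j\<le>N. \<phi> j * (real (N choose j) * krawtchouk N j k)\<bar> / 2 ^ N * \<rho> ^ k)"
  proof (intro sum.cong refl)
    fix k assume k: "k \<in> {..N}"
    have "real (N choose k) * \<bar>\<Sum>j\<le>N. \<phi> j * krawtchouk N k j\<bar>
        = \<bar>\<Sum>j\<le>N. \<phi> j * (real (N choose k) * krawtchouk N k j)\<bar>"
      by (subst abs_of_nat[symmetric], subst abs_mult[symmetric])
         (simp add: sum_distrib_left mult.left_commute)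
    also have "(\<Sum>j\<le>N. \<phi> j * (real (N choose k) * krawtchouk N k j))
        = (\<Sum>j\<le>N. \<phi> j * (real (N choose j) * krawtchouk N j k))"
      using k krawtchouk_reciprocity[of k N] by (intro sum.cong) auto
    finally show "real (N choose k) * d k * \<rho> ^ k
        = \<bar>\<Sum>j\<le>N. \<phi> j * (real (N choose j) * krawtchouk N j k)\<bar> / 2 ^ N * \<rho> ^ k"
      by (simp add: d_def)
  qed
  finally show ?thesis .
qed

section \<open>Threshold functions\<close>

definition cutoff :: "nat \<Rightarrow> real \<Rightarrow> nat" where
  "cutoff N \<alpha> = nat \<lfloor>(real N - \<alpha>) / 2\<rfloor>"

lemma le_cutoff_iff:
  assumes "\<alpha> \<le> real N"
  shows "j \<le> cutoff N \<alpha> \<longleftrightarrow> \<alpha> \<le> real N - 2 * real j"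
proof -
  have "0 \<le> \<lfloor>(real N - \<alpha>) / 2\<rfloor>" using assms by simp
  then have "j \<le> cutoff N \<alpha> \<longleftrightarrow> int j \<le> \<lfloor>(real N - \<alpha>) / 2\<rfloor>"
    by (simp add: cutoff_def le_nat_iff)
  also have "\<dots> \<longleftrightarrow> \<alpha> \<le> real N - 2 * real j"
    by (simp add: le_floor_iff) linarith
  finally show ?thesis .
qed

lemma cutoff_bounds:
  assumes "0 \<le> \<alpha>" "\<alpha> \<le> real N"
  shows "2 * cutoff N \<alpha> \<le> N" "\<alpha> \<le> real N - 2 * real (cutoff N \<alpha>)"
    "real (N - 2 * cutoff N \<alpha>) \<le> \<alpha> + 2"
proof -
  show a: "\<alpha> \<le> real N - 2 * real (cutoff N \<alpha>)"
    using le_cutoff_iff[OF assms(2), of "cutoff N \<alpha>"] by simp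
  show b: "2 * cutoff N \<alpha> \<le> N" using a assms(1) by linarith
  show "real (N - 2 * cutoff N \<alpha>) \<le> \<alpha> + 2"
    using le_cutoff_iff[OF assms(2), of "Suc (cutoff N \<alpha>)"] b by simp
qed

lemma threshold_point:
  assumes "A \<subseteq> {1..N}" "\<alpha> < real N"
  shows "threshold N \<alpha> (point N A) = 2 * of_bool (card A \<le> cutoff N \<alpha>) - 1"
  unfolding threshold_def sum_point[OF assms(1)]
  using le_cutoff_iff[of \<alpha> N "card A"] assms(2) by (simp add: sign1_def)

lemma cube_norm_threshold: "cube_norm N (threshold N \<alpha>) = 1"
proof -
  have "cube N \<noteq> {}" using bij_betw_imp_surj_on[OF bij_betw_point, of N] by blast
  then have "(\<lambda>x. \<bar>threshold N \<alpha> x\<bar>) ` cube N = {1}"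
    by (auto simp: threshold_def sign1_def image_def)
  then show ?thesis by (simp add: cube_norm_def)
qed

text \<open>
  Write the threshold function as twice an indicator function minus \<open>1\<close>; the constant
  contributes to level \<open>0\<close> only, by \<open>sum_krawtchouk_eq_0\<close>.
\<close>

lemma majorant_threshold:
  fixes N :: nat and \<alpha> :: real
  defines "J \<equiv> cutoff N \<alpha>"
  assumes \<alpha>: "0 \<le> \<alpha>" "\<alpha> < real N"
  shows "majorant N (threshold N \<alpha>) \<rho>
    = \<bar>2 * (\<Sum>j\<le>J. real (N choose j)) / 2 ^ N - 1\<bar>
      + 2 / 2 ^ N * (\<Sum>k=1..N. \<bar>\<Sum>j\<le>J. real (N choose j) * krawtchouk N j k\<bar> * \<rho> ^ k)"
proof -
  define c where "c k = (\<Sum>j\<le>J. real (N choose j) * krawtchouk N j k)" for k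
  define d where "d k = (\<Sum>j\<le>N. (2 * of_bool (j \<le> J) - 1) * (real (N choose j) * krawtchouk N j k))" for k
  have "J \<le> N" using cutoff_bounds(1)[of \<alpha> N] \<alpha> by (simp add: J_def)
  have d: "d k = 2 * c k - (\<Sum>j\<le>N. real (N choose j) * krawtchouk N j k)" for k
  proof -
    have "d k = (\<Sum>j\<le>N. 2 * (if j \<le> J then real (N choose j) * krawtchouk N j k else 0)
        - real (N choose j) * krawtchouk N j k)"
      unfolding d_def by (intro sum.cong) auto
    also have "\<dots> = 2 * (\<Sum>j\<le>N. if j \<le> J then real (N choose j) * krawtchouk N j k else 0)
        - (\<Sum>j\<le>N. real (N choose j) * krawtchouk N j k)"
      by (simp only: sum_subtractf sum_distrib_left)
    also have "(\<Sum>j\<le>N. if j \<le> J then real (N choose j) * krawtchouk N j k else 0) = c k"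
      unfolding c_def using \<open>J \<le> N\<close> by (intro sum.mono_neutral_cong_right) auto
    finally show ?thesis .
  qed
  have dk: "d k = 2 * c k" if k: "k \<in> {1..N}" for k
  proof -
    have "(\<Sum>j\<le>N. real (N choose j) * krawtchouk N j k) = (\<Sum>j\<le>N. real (N choose k) * krawtchouk N k j)"
      using k krawtchouk_reciprocity[of k N] by (intro sum.cong) auto
    also have "\<dots> = 0"
      using k sum_krawtchouk_eq_0[of k N] by (simp flip: sum_distrib_left)
    finally show ?thesis by (simp add: d)
  qed
  have "{..N} = insert 0 {1..N}" by auto
  moreover have "majorant N (threshold N \<alpha>) \<rho> = (\<Sum>k\<le>N. \<bar>d k\<bar> / 2 ^ N * \<rho> ^ k)"
    unfolding d_def using threshold_point[OF _ \<alpha>(2)]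
    by (intro majorant_symmetric) (simp add: J_def)
  ultimately have "majorant N (threshold N \<alpha>) \<rho>
      = \<bar>d 0\<bar> / 2 ^ N + (\<Sum>k=1..N. \<bar>d k\<bar> / 2 ^ N * \<rho> ^ k)"
    by simp
  also have "(\<Sum>k=1..N. \<bar>d k\<bar> / 2 ^ N * \<rho> ^ k) = 2 / 2 ^ N * (\<Sum>k=1..N. \<bar>c k\<bar> * \<rho> ^ k)"
    unfolding sum_distrib_left by (intro sum.cong) (auto simp: dk abs_mult)
  also have "\<bar>d 0\<bar> / 2 ^ N = \<bar>2 * c 0 / 2 ^ N - 1\<bar>"
  proof -
    have "d 0 / 2 ^ N = 2 * c 0 / 2 ^ N - 1"
      by (simp add: d krawtchouk_0 sum_choose_real diff_divide_distrib)
    then show ?thesis by (metis abs_divide abs_numeral power_abs)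
  qed
  finally show ?thesis by (simp add: c_def krawtchouk_0)
qed

text \<open>
  At \<open>r = 1 / (\<alpha> + sqrt N)\<close> the nonconstant part of the majorant is at most \<open>4 * exp 3 * p\<close>. The factor
  \<open>exp (-3) / 8\<close> reduces it to \<open>p / 2\<close>, and \<open>\<bar>2 * p - 1\<bar> + p / 2 \<le> 1\<close> for \<open>p\<close> between \<open>0\<close> and \<open>3 / 4\<close>.
\<close>

lemma majorant_threshold_le_1:
  fixes \<alpha> :: real
  assumes N: "1 \<le> N" and \<alpha>: "0 \<le> \<alpha>" "\<alpha> < real N"
  shows "majorant N (threshold N \<alpha>) (exp (-3) / 8 * (1 / (\<alpha> + sqrt (real N)))) \<le> 1"
proof -
  define J where "J = cutoff N \<alpha>"
  define T where "T = (\<Sum>j\<le>J. real (N choose j))"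
  define p where "p = T / 2 ^ N"
  define r where "r = 1 / (\<alpha> + sqrt (real N))"
  define F where "F = majorant N (threshold N \<alpha>)"
  have s: "1 \<le> sqrt (real N)" using N by simp
  have r: "0 < r" using s \<alpha> by (simp add: r_def add_nonneg_pos)
  have J: "2 * J \<le> N" "real (N - 2 * J) \<le> \<alpha> + 2"
    using cutoff_bounds[of \<alpha> N] \<alpha> by (simp_all add: J_def)
  have Nr: "real N * r\<^sup>2 \<le> 1"
  proof -
    have "0 < \<alpha> + sqrt (real N)" using s \<alpha> by linarith
    then have "sqrt (real N) * r \<le> 1" using \<alpha> by (simp add: r_def pos_divide_le_eq)
    then have "(sqrt (real N) * r)\<^sup>2 \<le> 1" using r by (intro power_le_one) auto
    then show ?thesis by (simp add: power_mult_distrib)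
  qed
  have T0: "0 \<le> T" unfolding T_def by (intro sum_nonneg) auto
  \<comment> \<open>the sum of the coordinates exceeds \<open>\<alpha>\<close> by less than \<open>2\<close> at the threshold level \<open>J\<close>,
    and \<open>sqrt N \<ge> 1\<close>\<close>
  have "(1 + r) ^ (N - 2 * J) \<le> exp r ^ (N - 2 * J)"
    using r by (intro power_mono) auto
  also have "\<dots> = exp (real (N - 2 * J) * r)"
    by (simp add: exp_of_nat_mult)
  also have "\<dots> \<le> exp 2"
  proof -
    have "real (N - 2 * J) * r \<le> (\<alpha> + 2) * r"
      using J r by (intro mult_right_mono) auto
    also have "\<dots> \<le> 2"
    proof -
      have "\<alpha> + 2 \<le> 2 * \<alpha> + 2 * sqrt (real N)" using s \<alpha> by linarith
      moreover have "0 < \<alpha> + sqrt (real N)" using s \<alpha> by linarith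
      ultimately show ?thesis by (simp add: r_def pos_divide_le_eq)
    qed
    finally show ?thesis by simp
  qed
  finally have top: "(1 + r) ^ (N - 2 * J) \<le> exp 2" .
  have "(\<Sum>k=1..N. \<bar>\<Sum>j\<le>J. real (N choose j) * krawtchouk N j k\<bar> * r ^ k)
      \<le> (\<Sum>k\<le>N. \<bar>\<Sum>j\<le>J. real (N choose j) * krawtchouk N j k\<bar> * r ^ k)"
    using r by (intro sum_mono2) auto
  also have "\<dots> \<le> (\<Sum>k\<le>N. \<Sum>j\<le>J. real (N choose j) * (\<bar>krawtchouk N j k\<bar> * r ^ k))"
  proof (intro sum_mono)
    fix k
    have "\<bar>\<Sum>j\<le>J. real (N choose j) * krawtchouk N j k\<bar> * r ^ k
        \<le> (\<Sum>j\<le>J. real (N choose j) * \<bar>krawtchouk N j k\<bar>) * r ^ k"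
      using r by (intro mult_right_mono order_trans[OF sum_abs]) (auto simp: abs_mult)
    then show "\<bar>\<Sum>j\<le>J. real (N choose j) * krawtchouk N j k\<bar> * r ^ k
        \<le> (\<Sum>j\<le>J. real (N choose j) * (\<bar>krawtchouk N j k\<bar> * r ^ k))"
      by (simp add: sum_distrib_right mult.assoc)
  qed
  also have "\<dots> = (\<Sum>j\<le>J. real (N choose j) * (\<Sum>k\<le>N. \<bar>krawtchouk N j k\<bar> * r ^ k))"
    by (subst sum.swap) (simp add: sum_distrib_left)
  also have "\<dots> \<le> (\<Sum>j\<le>J. real (N choose j) * (exp (1/2) * (1 + r) ^ (N - 2 * j)))"
  proof (intro sum_mono mult_left_mono)
    fix j assume j: "j \<in> {..J}"
    have "(1 + r\<^sup>2) ^ j \<le> exp (r\<^sup>2) ^ j"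
      by (intro power_mono) auto
    also have "\<dots> = exp (real j * r\<^sup>2)"
      by (simp add: exp_of_nat_mult)
    also have "\<dots> \<le> exp (1/2)"
    proof -
      have "real j * r\<^sup>2 \<le> real N / 2 * r\<^sup>2"
        using j J(1) by (intro mult_right_mono) auto
      then show ?thesis using Nr by simp
    qed
    finally have le: "(1 + r\<^sup>2) ^ j * (1 + r) ^ (N - 2 * j) \<le> exp (1/2) * (1 + r) ^ (N - 2 * j)"
      using r by (intro mult_right_mono) auto
    show "(\<Sum>k\<le>N. \<bar>krawtchouk N j k\<bar> * r ^ k) \<le> exp (1/2) * (1 + r) ^ (N - 2 * j)"
      using j J(1) r by (intro order_trans[OF sum_abs_krawtchouk_le le]) auto
  qed simp
  also have "\<dots> = exp (1/2) * (\<Sum>j\<le>J. real (N choose j) * (1 + r) ^ (N - 2 * j))"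
    by (simp add: sum_distrib_left mult_ac)
  also have "\<dots> \<le> exp (1/2) * (2 * exp (1/2) * (1 + r) ^ (N - 2 * J) * T)"
    unfolding T_def using J(1) r Nr by (intro mult_left_mono exp_tail_le) auto
  also have "\<dots> = 2 * exp 1 * (1 + r) ^ (N - 2 * J) * T"
    by (simp flip: exp_add)
  also have "\<dots> \<le> 2 * exp 1 * exp 2 * T"
    using top T0 by (intro mult_right_mono mult_left_mono) auto
  also have "\<dots> = 2 * exp 3 * T"
    by (simp flip: exp_add)
  finally have "2 / 2 ^ N * (\<Sum>k=1..N. \<bar>\<Sum>j\<le>J. real (N choose j) * krawtchouk N j k\<bar> * r ^ k)
      \<le> 2 / 2 ^ N * (2 * exp 3 * T)"
    by (intro mult_left_mono) auto
  then have Fr: "F r \<le> \<bar>2 * p - 1\<bar> + 4 * exp 3 * p"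
    unfolding F_def majorant_threshold[OF \<alpha>] J_def[symmetric] p_def T_def by simp
  have F0: "F 0 = \<bar>2 * p - 1\<bar>"
    unfolding F_def majorant_threshold[OF \<alpha>] J_def[symmetric] p_def T_def
    by (simp add: power_0_left sum.delta' if_distrib)
  have p: "0 \<le> p" "p \<le> 3 / 4"
    using T0 sum_choose_le_three_quarters[OF N J(1)] by (auto simp: p_def T_def field_simps)
  have "exp (-3 :: real) \<le> 1" by simp
  then have "exp (-3 :: real) / 8 \<le> 1" by linarith
  then have "F (exp (-3) / 8 * r) \<le> (1 - exp (-3) / 8) * F 0 + exp (-3) / 8 * F r"
    unfolding F_def using r by (intro majorant_scale_le) simp_all
  also have "\<dots> \<le> (1 - exp (-3) / 8) * \<bar>2 * p - 1\<bar> + exp (-3) / 8 * (\<bar>2 * p - 1\<bar> + 4 * exp 3 * p)"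
    using Fr by (simp add: F0)
  also have "\<dots> = \<bar>2 * p - 1\<bar> + p / 2"
    by (simp add: algebra_simps exp_minus)
  also have "\<dots> \<le> 1" using p by (auto simp: abs_if)
  finally show ?thesis by (simp add: F_def r_def)
qed

text \<open>
  Levels \<open>0\<close> and \<open>1\<close> suffice: the first is \<open>\<bar>2 * p - 1\<bar>\<close>, and the second is at least \<open>2 * p\<close> as soon as
  \<open>\<rho> * M \<ge> T\<close>. The constant \<open>5\<close> comes from adding \<open>\<alpha> * T \<le> M\<close> and \<open>sqrt N * T \<le> 4 * M\<close>.
\<close>

lemma majorant_threshold_ge_1:
  fixes \<alpha> :: real
  assumes N: "1 \<le> N" and \<alpha>: "0 \<le> \<alpha>" "\<alpha> < real N"
  shows "1 \<le> majorant N (threshold N \<alpha>) (5 * (1 / (\<alpha> + sqrt (real N))))"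
proof -
  define J where "J = cutoff N \<alpha>"
  define T where "T = (\<Sum>j\<le>J. real (N choose j))"
  define M where "M = (\<Sum>j\<le>J. real (N choose j) * (real N - 2 * real j))"
  define s where "s = sqrt (real N)"
  define \<rho> where "\<rho> = 5 * (1 / (\<alpha> + s))"
  have s: "1 \<le> s" using N by (simp add: s_def)
  have J: "2 * J \<le> N" "\<alpha> \<le> real N - 2 * real J"
    using cutoff_bounds[of \<alpha> N] \<alpha> by (simp_all add: J_def)
  have T0: "0 \<le> T" unfolding T_def by (intro sum_nonneg) auto
  have "\<alpha> * T \<le> M"
    unfolding T_def M_def sum_distrib_left
  proof (intro sum_mono)
    fix j assume "j \<in> {..J}"
    then have "real (N choose j) * \<alpha> \<le> real (N choose j) * (real N - 2 * real j)"
      using J by (intro mult_left_mono) auto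
    then show "\<alpha> * real (N choose j) \<le> real (N choose j) * (real N - 2 * real j)"
      by (simp add: mult.commute)
  qed
  moreover have "s * T \<le> 4 * M"
    using sqrt_mult_sum_choose_le[OF J(1) N] by (simp add: s_def T_def M_def)
  ultimately have "T \<le> \<rho> * M"
    using s \<alpha> by (simp add: \<rho>_def pos_le_divide_eq algebra_simps)
  have "M = (\<Sum>j\<le>J. real (N choose j) * krawtchouk N j 1)"
    unfolding M_def using J by (intro sum.cong) (auto simp: krawtchouk_1 simp del: One_nat_def)
  then have "\<rho> * M \<le> (\<Sum>k\<in>{1}. \<bar>\<Sum>j\<le>J. real (N choose j) * krawtchouk N j k\<bar> * \<rho> ^ k)"
    using s \<alpha> by (simp add: \<rho>_def mult.commute divide_right_mono)
  also have "\<dots> \<le> (\<Sum>k=1..N. \<bar>\<Sum>j\<le>J. real (N choose j) * krawtchouk N j k\<bar> * \<rho> ^ k)"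
    using N s \<alpha> by (intro sum_mono2) (auto simp: \<rho>_def)
  finally have "T \<le> (\<Sum>k=1..N. \<bar>\<Sum>j\<le>J. real (N choose j) * krawtchouk N j k\<bar> * \<rho> ^ k)"
    using \<open>T \<le> \<rho> * M\<close> by simp
  then have "2 / 2 ^ N * T
      \<le> 2 / 2 ^ N * (\<Sum>k=1..N. \<bar>\<Sum>j\<le>J. real (N choose j) * krawtchouk N j k\<bar> * \<rho> ^ k)"
    by (intro mult_left_mono) auto
  then have "majorant N (threshold N \<alpha>) \<rho> \<ge> \<bar>2 * T / 2 ^ N - 1\<bar> + 2 * T / 2 ^ N"
    unfolding majorant_threshold[OF \<alpha>] J_def[symmetric] T_def by simp
  then have "1 \<le> majorant N (threshold N \<alpha>) \<rho>"
    by linarith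
  then show ?thesis by (simp add: \<rho>_def s_def)
qed

theorem theorem5p4:
  shows "\<exists>C::real. C > 0 \<and>
    (\<forall>(N::nat) (\<alpha>::real). 1 \<le> N \<longrightarrow> 0 \<le> \<alpha> \<longrightarrow> \<alpha> < real N \<longrightarrow>
       inverse C * (1 / (\<alpha> + sqrt (real N))) \<le> boolean_radius N (threshold N \<alpha>) \<and>
       boolean_radius N (threshold N \<alpha>) \<le> C * (1 / (\<alpha> + sqrt (real N))))"
proof (intro exI[of _ "8 * exp 3"] conjI allI impI)
  fix N :: nat and \<alpha> :: real
  assume N: "1 \<le> N" and \<alpha>: "0 \<le> \<alpha>" "\<alpha> < real N"
  define J where "J = cutoff N \<alpha>"
  define p where "p = (\<Sum>j\<le>J. real (N choose j)) / 2 ^ N"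
  define r where "r = 1 / (\<alpha> + sqrt (real N))"
  have r: "0 < r" using \<alpha> N by (simp add: r_def add_nonneg_pos)
  have "2 * J \<le> N" using cutoff_bounds(1)[of \<alpha> N] \<alpha> by (simp add: J_def)
  then have "p \<le> 3 / 4"
    using sum_choose_le_three_quarters[OF N] by (simp add: p_def field_simps)
  moreover have "0 < p"
    unfolding p_def by (intro divide_pos_pos sum_pos2[of _ 0]) auto
  moreover have "majorant N (threshold N \<alpha>) 0 = \<bar>2 * p - 1\<bar>"
    unfolding majorant_threshold[OF \<alpha>] J_def[symmetric] p_def
    by (simp add: power_0_left)
  ultimately have mean: "\<bar>cube_mean N (threshold N \<alpha>)\<bar> < cube_norm N (threshold N \<alpha>)"
    by (simp add: majorant_0 cube_norm_threshold abs_less_iff)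
  have inv: "inverse (8 * exp 3) = exp (-3) / (8 :: real)"
    by (simp add: exp_minus field_simps)
  have "exp (-3 :: real) \<le> 1" by simp
  then have "exp (-3) / 8 * r \<le> 5 * r"
    using r by (intro mult_right_mono) linarith+
  note bounds = boolean_radius_between[OF mean, of "exp (-3) / 8 * r" "5 * r"]
  show "inverse (8 * exp 3) * (1 / (\<alpha> + sqrt (real N))) \<le> boolean_radius N (threshold N \<alpha>)"
    using bounds(1) r \<open>exp (-3) / 8 * r \<le> 5 * r\<close>
      majorant_threshold_le_1[OF N \<alpha>] majorant_threshold_ge_1[OF N \<alpha>]
    unfolding inv by (simp add: r_def cube_norm_threshold)
  have "5 * r \<le> 8 * exp 3 * r"
    using r exp_ge_add_one_self[of "3 :: real"] by (intro mult_right_mono) auto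
  then show "boolean_radius N (threshold N \<alpha>) \<le> 8 * exp 3 * (1 / (\<alpha> + sqrt (real N)))"
    using bounds(2) r \<open>exp (-3) / 8 * r \<le> 5 * r\<close>
      majorant_threshold_le_1[OF N \<alpha>] majorant_threshold_ge_1[OF N \<alpha>]
    by (simp add: r_def cube_norm_threshold)
qed simp

end
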